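(* Let $M$ and $N$ be Hermitian manifolds (complex manifolds of positive dimension, each equipped with a Hermitian metric) whose holomorphic sectional curvatures $K_M$ and $K_N$ are positive and $c_M$-pinched and $c_N$-pinched respectively, where $c_M,c_N\in(0,1]$. Suppose that there is a constant $k>0$ such that $$kc_M\le K_M\le k\quad\text{and}\quad kc_N\le K_N\le k$$ for all non-zero tangent vectors of $M$ and $N$, respectively. Then the holomorphic sectional curvature $K$ of the product metric on $M\times N$ satisfies $$k\,\frac{c_Mc_N}{c_M+c_N}\le K\le k$$ for all non-zero tangent vectors of $M\times N$, and it is $\frac{c_Mc_N}{c_M+c_N}$-pinched.
   Context: Let $X$ be an $m$-dimensional complex manifold with local holomorphic coordinates $z_1,\dots,z_m$ and Hermitian metric $g=\sum_{i,j=1}^m g_{i\bar j}\,dz_i\otimes d\bar z_j$ (not assumed Kähler). The curvature components (of the metric, i.e. Chern, connection) are $$R_{i\bar jk\bar l}=-\frac{\partial^2 g_{i\bar j}}{\partial z_k\partial\bar z_l}+\sum_{p,q=1}^m g^{p\bar q}\frac{\partial g_{i\bar p}}{\partial z_k}\frac{\partial g_{q\bar j}}{\partial\bar z_l},$$ where $(g^{p\bar q})$ is the inverse matrix of $(g_{i\bar j})$. For a non-zero tangent vector $\xi=\sum_i\xi_i\frac{\partial}{\partial z_i}$ at a point $p\in X$, the holomorphic sectional curvature is $$K(\xi)=\Big(2\sum_{i,j,k,l=1}^m R_{i\bar jk\bar l}(p)\,\xi_i\bar\xi_j\xi_k\bar\xi_l\Big)\Big/\Big(\sum_{i,j,k,l=1}^m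 g_{i\bar j}(p)g_{k\bar l}(p)\,\xi_i\bar\xi_j\xi_k\bar\xi_l\Big).$$ For a constant $c\in(0,1]$, positive holomorphic sectional curvature is called $c$-pinched if $\frac{\inf_\xi K(\xi)}{\sup_\xi K(\xi)}=c$ (equality), where the infimum and supremum are over all non-zero tangent vectors at all points of the manifold. If $M$ has local coordinates $z_1,\dots,z_m$ and metric $\sum_{i,j=1}^m g_{i\bar j}\,dz_i\otimes d\bar z_j$, and $N$ has local coordinates $z_{m+1},\dots,z_{m+n}$ and metric $\sum_{i,j=m+1}^{m+n}h_{i\bar j}\,dz_i\otimes d\bar z_j$, the product metric on $M\times N$ is locally the sum $\sum_{i,j=1}^m g_{i\bar j}\,dz_i\otimes d\bar z_j+\sum_{i,j=m+1}^{m+n}h_{i\bar j}\,dz_i\otimes d\bar z_j$. *)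

theory Defs
  imports "HOL-Analysis.Analysis"
begin

section \<open>Calculus on open subsets of complex \<open>m\<close>-space\<close>

definition dz :: "'m::finite \<Rightarrow> (complex^'m \<Rightarrow> complex) \<Rightarrow> complex^'m \<Rightarrow> complex" where
  "dz k f z = (frechet_derivative f (at z) (axis k 1)
                - \<i> * frechet_derivative f (at z) (axis k \<i>)) / 2"

definition dzbar :: "'m::finite \<Rightarrow> (complex^'m \<Rightarrow> complex) \<Rightarrow> complex^'m \<Rightarrow> complex" where
  "dzbar k f z = (frechet_derivative f (at z) (axis k 1)
                   + \<i> * frechet_derivative f (at z) (axis k \<i>)) / 2"

text \<open>\<open>Ck_on n S f\<close> is intended for open \<open>S\<close>; differentiability is over the reals.\<close>

fun Ck_on :: "nat \<Rightarrow> 'a::euclidean_space set \<Rightarrow> ('a \<Rightarrow> 'b::euclidean_space) \<Rightarrow> bool" where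
  "Ck_on 0 S f \<longleftrightarrow> continuous_on S f"
| "Ck_on (Suc n) S f \<longleftrightarrow> (\<forall>x\<in>S. f differentiable (at x)) \<and>
     (\<forall>v. Ck_on n S (\<lambda>x. frechet_derivative f (at x) v))"

definition smooth_on :: "'a::euclidean_space set \<Rightarrow> ('a \<Rightarrow> 'b::euclidean_space) \<Rightarrow> bool" where
  "smooth_on S f \<longleftrightarrow> (\<forall>n. Ck_on n S f)"

text \<open>Holomorphy of a map between open subsets of complex vector spaces: at every point it has
  a complex linear Frechet derivative.\<close>

definition holomorphic_map_on :: "(complex^'m) set \<Rightarrow> (complex^'m \<Rightarrow> complex^'n) \<Rightarrow> bool" where
  "holomorphic_map_on S f \<longleftrightarrow>
     (\<forall>z\<in>S. \<exists>f'. (f has_derivative f') (at z) \<and> (\<forall>c v. f' (c *s v) = c *s f' v))"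


section \<open>Complex manifolds and Hermitian metrics\<close>

text \<open>An atlas is a family of charts indexed by a set of labels; the chart labelled \<open>i\<close> is the
  coordinate map \<open>coord M i\<close>, of which only the values on \<open>chart_dom M i\<close> are
  meaningful. The complex dimension is \<open>CARD('m)\<close>, hence positive.\<close>

record ('i, 'a, 'm) atlas =
  space_top :: "'a topology"
  charts :: "'i set"
  chart_dom :: "'i \<Rightarrow> 'a set"
  coord :: "'i \<Rightarrow> 'a \<Rightarrow> complex^'m"

definition chart_img :: "('i, 'a, 'm) atlas \<Rightarrow> 'i \<Rightarrow> (complex^'m) set" where
  "chart_img M i = coord M i ` chart_dom M i"

definition transition :: "('i, 'a, 'm) atlas \<Rightarrow> 'i \<Rightarrow> 'i \<Rightarrow> complex^'m \<Rightarrow> complex^'m" where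
  "transition M i j z = coord M j (inv_into (chart_dom M i) (coord M i) z)"

definition complex_manifold :: "('i, 'a, 'm::finite) atlas \<Rightarrow> bool" where
  "complex_manifold M \<longleftrightarrow>
     Hausdorff_space (space_top M) \<and> second_countable (space_top M) \<and>
     (\<Union>i\<in>charts M. chart_dom M i) = topspace (space_top M) \<and>
     (\<forall>i\<in>charts M. openin (space_top M) (chart_dom M i) \<and> open (chart_img M i) \<and>
        homeomorphic_map (subtopology (space_top M) (chart_dom M i))
          (top_of_set (chart_img M i)) (coord M i)) \<and>
     (\<forall>i\<in>charts M. \<forall>j\<in>charts M.
        holomorphic_map_on (coord M i ` (chart_dom M i \<inter> chart_dom M j)) (transition M i j))"

text \<open>A metric is given by its components: \<open>g i z $ a $ b\<close> is the component
  \<open>g\<^sub>a\<^sub>b\<^sub>b\<^sub>a\<^sub>r\<close> in the coordinates of the chart \<open>i\<close>, as a function of the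
  coordinates \<open>z\<close>. The last conjunct is the transformation law of the tensor
  \<open>\<Sum> g\<^sub>a\<^sub>b\<^sub>b\<^sub>a\<^sub>r dz\<^sub>a \<otimes> dzbar\<^sub>b\<close>, by which the local
  components define a global tensor.\<close>

type_synonym ('i, 'm) metric = "'i \<Rightarrow> complex^'m \<Rightarrow> complex^'m^'m"

definition hermitian_metric :: "('i, 'a, 'm::finite) atlas \<Rightarrow> ('i, 'm) metric \<Rightarrow> bool" where
  "hermitian_metric M g \<longleftrightarrow>
     (\<forall>i\<in>charts M.
        (\<forall>a b. smooth_on (chart_img M i) (\<lambda>z. g i z $ a $ b)) \<and>
        (\<forall>z\<in>chart_img M i.
           (\<forall>a b. g i z $ b $ a = cnj (g i z $ a $ b)) \<and>
           (\<forall>\<xi>. \<xi> \<noteq> 0 \<longrightarrow>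
              0 < Re (\<Sum>a\<in>UNIV. \<Sum>b\<in>UNIV. g i z $ a $ b * \<xi> $ a * cnj (\<xi> $ b))))) \<and>
     (\<forall>i\<in>charts M. \<forall>j\<in>charts M. \<forall>z \<in> coord M i ` (chart_dom M i \<inter> chart_dom M j). \<forall>a b.
        g i z $ a $ b =
          (\<Sum>c\<in>UNIV. \<Sum>d\<in>UNIV. g j (transition M i j z) $ c $ d *
             dz a (\<lambda>w. transition M i j w $ c) z * cnj (dz b (\<lambda>w. transition M i j w $ d) z)))"


section \<open>Holomorphic sectional curvature\<close>

definition chern_curvature ::
  "(complex^'m \<Rightarrow> complex^'m^'m) \<Rightarrow> complex^'m \<Rightarrow> 'm \<Rightarrow> 'm \<Rightarrow> 'm \<Rightarrow> 'm::finite \<Rightarrow> complex" where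
  "chern_curvature G z i j k l =
     - dz k (dzbar l (\<lambda>w. G w $ i $ j)) z
     + (\<Sum>p\<in>UNIV. \<Sum>q\<in>UNIV. matrix_inv (G z) $ p $ q *
          dz k (\<lambda>w. G w $ i $ p) z * dzbar l (\<lambda>w. G w $ q $ j) z)"

text \<open>The triple \<open>(i, x, \<xi>)\<close> stands for the tangent vector at \<open>x\<close> with components
  \<open>\<xi>\<close> in the coordinates of the chart \<open>i\<close>. A tangent vector has one such
  representation for every chart around its base point.\<close>

definition nonzero_tangent_vectors :: "('i, 'a, 'm::finite) atlas \<Rightarrow> ('i \<times> 'a \<times> (complex^'m)) set" where
  "nonzero_tangent_vectors M = {(i, x, \<xi>). i \<in> charts M \<and> x \<in> chart_dom M i \<and> \<xi> \<noteq> 0}"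

text \<open>For a Hermitian metric the numerator and the denominator are real, so taking the real part
  only changes the type.\<close>

definition hol_sect_curv ::
  "('i, 'a, 'm::finite) atlas \<Rightarrow> ('i, 'm) metric \<Rightarrow> 'i \<times> 'a \<times> (complex^'m) \<Rightarrow> real" where
  "hol_sect_curv M g = (\<lambda>(i, x, \<xi>). let z = coord M i x in
     Re ((2 * (\<Sum>a\<in>UNIV. \<Sum>b\<in>UNIV. \<Sum>c\<in>UNIV. \<Sum>d\<in>UNIV.
               chern_curvature (g i) z a b c d * \<xi> $ a * cnj (\<xi> $ b) * \<xi> $ c * cnj (\<xi> $ d)))
         / (\<Sum>a\<in>UNIV. \<Sum>b\<in>UNIV. \<Sum>c\<in>UNIV. \<Sum>d\<in>UNIV.
               g i z $ a $ b * g i z $ c $ d * \<xi> $ a * cnj (\<xi> $ b) * \<xi> $ c * cnj (\<xi> $ d))))"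

definition positive_hsc :: "('i, 'a, 'm::finite) atlas \<Rightarrow> ('i, 'm) metric \<Rightarrow> bool" where
  "positive_hsc M g \<longleftrightarrow> (\<forall>v\<in>nonzero_tangent_vectors M. 0 < hol_sect_curv M g v)"

text \<open>Infimum and supremum are taken in the extended reals: over \<open>real\<close> they would be
  unspecified for an unbounded curvature or an empty manifold, neither of which is pinched.\<close>

definition pinched :: "('i, 'a, 'm::finite) atlas \<Rightarrow> ('i, 'm) metric \<Rightarrow> real \<Rightarrow> bool" where
  "pinched M g c \<longleftrightarrow> 0 < c \<and> c \<le> 1 \<and> positive_hsc M g \<and>
     (INF v\<in>nonzero_tangent_vectors M. ereal (hol_sect_curv M g v)) /
     (SUP v\<in>nonzero_tangent_vectors M. ereal (hol_sect_curv M g v)) = ereal c"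


section \<open>Products\<close>

text \<open>The index type \<open>'m + 'n\<close> lists the coordinates of the first factor and then those of
  the second.\<close>

definition vec_pair :: "complex^('m::finite) \<Rightarrow> complex^('n::finite) \<Rightarrow> complex^('m + 'n)" where
  "vec_pair z w = (\<chi> s. case s of Inl a \<Rightarrow> z $ a | Inr b \<Rightarrow> w $ b)"

definition vec_left :: "complex^('m::finite + 'n::finite) \<Rightarrow> complex^'m" where
  "vec_left u = (\<chi> a. u $ Inl a)"

definition vec_right :: "complex^('m::finite + 'n::finite) \<Rightarrow> complex^'n" where
  "vec_right u = (\<chi> b. u $ Inr b)"

definition product_manifold ::
  "('i, 'a, 'm::finite) atlas \<Rightarrow> ('j, 'b, 'n::finite) atlas \<Rightarrow> ('i \<times> 'j, 'a \<times> 'b, 'm + 'n) atlas" where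
  "product_manifold M N =
     \<lparr>space_top = prod_topology (space_top M) (space_top N),
      charts = charts M \<times> charts N,
      chart_dom = (\<lambda>(i, j). chart_dom M i \<times> chart_dom N j),
      coord = (\<lambda>(i, j) (x, y). vec_pair (coord M i x) (coord N j y))\<rparr>"

definition product_metric ::
  "('i, 'm::finite) metric \<Rightarrow> ('j, 'n::finite) metric \<Rightarrow> ('i \<times> 'j, 'm + 'n) metric" where
  "product_metric g h = (\<lambda>(i, j) u. \<chi> s t.
     (case (s, t) of
        (Inl a, Inl b) \<Rightarrow> g i (vec_left u) $ a $ b
      | (Inr a, Inr b) \<Rightarrow> h j (vec_right u) $ a $ b
      | _ \<Rightarrow> 0))"

end

theory Submission
  imports Defs
begin

text \<open>In product coordinates the metric is a block diagonal matrix \<open>block_diag G H\<close> in which \<open>G\<close>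
  depends on the first group of coordinates only and \<open>H\<close> on the second. Hence every component of the
  Chern curvature that mixes the groups vanishes, the others are those of the factors, and the quartic
  curvature form of a vector \<open>(\<alpha>, \<beta>)\<close> is the sum of the forms of \<open>\<alpha>\<close> and \<open>\<beta>\<close>
  (\<open>curvature_form_block_diag\<close>). Writing \<open>A\<close> and \<open>B\<close> for the squared norms of \<open>\<alpha>\<close> and \<open>\<beta>\<close>,
  this reads (\<open>hol_sect_curv_product\<close>)
  \<open>K(\<alpha>, \<beta>) = (K\<^sub>M(\<alpha>) A\<^sup>2 + K\<^sub>N(\<beta>) B\<^sup>2) / (A + B)\<^sup>2\<close>.

  The bounds on the factors reduce the estimate of \<open>K\<close> to that of
  \<open>(p A\<^sup>2 + q B\<^sup>2) / (A + B)\<^sup>2\<close> for \<open>A, B \<ge> 0\<close>: it is at most 1 for \<open>p = q = 1\<close>, and for \<open>p, q > 0\<close> its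
  minimum is \<open>p q / (p + q)\<close>, attained at \<open>A : B = q : p\<close>.

  Both bounds are sharp. Given the bounds, the pinching equalities force the infimum and the supremum
  of \<open>K\<^sub>M\<close> to be \<open>k c\<^sub>M\<close> and \<open>k\<close>, and likewise for \<open>N\<close> (\<open>pinched_imp_extremal\<close>). Vectors \<open>(\<alpha>, 0)\<close> then
  bring \<open>K\<close> near \<open>k\<close>. Since the curvature ignores positive scaling, \<open>\<alpha>\<close> and \<open>\<beta>\<close> of almost minimal
  curvature can be given the squared norms \<open>c\<^sub>N\<close> and \<open>c\<^sub>M\<close>, and this brings \<open>K\<close> near
  \<open>k c\<^sub>M c\<^sub>N / (c\<^sub>M + c\<^sub>N)\<close>.\<close>

section \<open>The Wirtinger derivatives of functions of one factor\<close>

lemma linear_vec_left: "linear (vec_left :: complex^('m::finite + 'n::finite) \<Rightarrow> complex^'m)"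
  by (rule linearI) (simp_all add: vec_left_def vec_eq_iff)

lemma linear_vec_right: "linear (vec_right :: complex^('m::finite + 'n::finite) \<Rightarrow> complex^'n)"
  by (rule linearI) (simp_all add: vec_right_def vec_eq_iff)

lemma vec_left_right_nth [simp]: "vec_left u $ a = u $ Inl a" "vec_right u $ b = u $ Inr b"
  by (simp_all add: vec_left_def vec_right_def)

lemma vec_left_axis [simp]:
  "vec_left (axis (Inl k) c) = axis k c" "vec_left (axis (Inr l) c) = 0"
  by (simp_all add: vec_left_def vec_eq_iff axis_def)

lemma vec_right_axis [simp]:
  "vec_right (axis (Inl k) c) = 0" "vec_right (axis (Inr l) c) = axis l c"
  by (simp_all add: vec_right_def vec_eq_iff axis_def)

lemma vec_left_right_pair [simp]:
  "vec_left (vec_pair z w) = z" "vec_right (vec_pair z w) = w"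
  by (simp_all add: vec_left_def vec_right_def vec_pair_def vec_eq_iff)

lemma vec_eq_0_iff_left_right: "u = 0 \<longleftrightarrow> vec_left u = 0 \<and> vec_right u = 0"
  for u :: "complex^('m::finite + 'n::finite)"
proof -
  have "(\<forall>s. u $ s = 0) \<longleftrightarrow> (\<forall>a. u $ Inl a = 0) \<and> (\<forall>b. u $ Inr b = 0)"
    by (metis sum.exhaust)
  then show ?thesis
    by (simp add: vec_left_def vec_right_def vec_eq_iff)
qed

lemma sum_UNIV_Plus:
  fixes f :: "'m::finite + 'n::finite \<Rightarrow> 'c::comm_monoid_add"
  shows "(\<Sum>s\<in>UNIV. f s) = (\<Sum>a\<in>UNIV. f (Inl a)) + (\<Sum>b\<in>UNIV. f (Inr b))"
  by (simp add: UNIV_Plus_UNIV [symmetric] sum.Plus comp_def del: UNIV_Plus_UNIV)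

lemma frechet_derivative_comp_linear:
  fixes L :: "'a::euclidean_space \<Rightarrow> 'b::euclidean_space" and f :: "'b \<Rightarrow> 'c::real_normed_vector"
  assumes "linear L" "f differentiable (at (L u))"
  shows "frechet_derivative (\<lambda>w. f (L w)) (at u) = (\<lambda>v. frechet_derivative f (at (L u)) (L v))"
proof -
  have "(L has_derivative L) (at u)"
    using assms(1) by (simp add: linear_imp_has_derivative)
  moreover have "(f has_derivative frechet_derivative f (at (L u))) (at (L u))"
    using assms(2) by (simp add: frechet_derivative_works)
  ultimately have "((\<lambda>w. f (L w)) has_derivative (\<lambda>v. frechet_derivative f (at (L u)) (L v))) (at u)"
    by (rule has_derivative_compose)
  then show ?thesis
    by (rule frechet_derivative_at [symmetric])
qed

lemma frechet_derivative_eq_0: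
  "f differentiable (at z) \<Longrightarrow> frechet_derivative f (at z) 0 = 0"
  by (simp add: linear_frechet_derivative linear_0)

lemma dz_const [simp]: "dz k (\<lambda>w. c) z = 0" and dzbar_const [simp]: "dzbar k (\<lambda>w. c) z = 0"
  by (simp_all add: dz_def dzbar_def)

lemma dz_dzbar_const [simp]: "dz k (dzbar l (\<lambda>w. c)) z = 0"
proof -
  have "dzbar l (\<lambda>w. c) = (\<lambda>w. 0)"
    by (rule ext) simp
  then show ?thesis
    by simp
qed

lemma dz_comp_vec_left:
  assumes "f differentiable (at (vec_left u))"
  shows "dz (Inl k) (\<lambda>w. f (vec_left w)) u = dz k f (vec_left u)"
    and "dz (Inr l) (\<lambda>w. f (vec_left w)) u = 0"
    and "dzbar (Inl k) (\<lambda>w. f (vec_left w)) u = dzbar k f (vec_left u)"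
    and "dzbar (Inr l) (\<lambda>w. f (vec_left w)) u = 0"
  using frechet_derivative_comp_linear [OF linear_vec_left assms] frechet_derivative_eq_0 [OF assms]
  by (simp_all add: dz_def dzbar_def)

lemma dz_comp_vec_right:
  assumes "f differentiable (at (vec_right u))"
  shows "dz (Inr k) (\<lambda>w. f (vec_right w)) u = dz k f (vec_right u)"
    and "dz (Inl l) (\<lambda>w. f (vec_right w)) u = 0"
    and "dzbar (Inr k) (\<lambda>w. f (vec_right w)) u = dzbar k f (vec_right u)"
    and "dzbar (Inl l) (\<lambda>w. f (vec_right w)) u = 0"
  using frechet_derivative_comp_linear [OF linear_vec_right assms] frechet_derivative_eq_0 [OF assms]
  by (simp_all add: dz_def dzbar_def)

lemma dz_cong_open:
  assumes "open S" "z \<in> S" "\<And>w. w \<in> S \<Longrightarrow> f w = f' w"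
  shows "dz k f z = dz k f' z"
proof -
  have "(f has_derivative D) (at z) \<longleftrightarrow> (f' has_derivative D) (at z)" for D
    using has_derivative_transform_within_open [OF _ assms(1,2), of f D UNIV f']
      has_derivative_transform_within_open [OF _ assms(1,2), of f' D UNIV f] assms(3) by auto
  then show ?thesis
    by (simp add: dz_def frechet_derivative_def)
qed

text \<open>This is the regularity under which the second derivatives in the curvature obey the chain rule.
  It concerns a set, later an open one, because a second derivative at a point involves the first
  derivatives on a neighbourhood.\<close>

definition dzbar_differentiable_on :: "(complex^'m) set \<Rightarrow> (complex^'m::finite \<Rightarrow> complex) \<Rightarrow> bool" where
  "dzbar_differentiable_on S f \<longleftrightarrow>
     (\<forall>z\<in>S. f differentiable (at z) \<and> (\<forall>l. dzbar l f differentiable (at z)))"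

lemma smooth_on_imp_dzbar_differentiable_on:
  assumes "smooth_on S f"
  shows "dzbar_differentiable_on S f"
proof -
  have "Ck_on (Suc (Suc 0)) S f"
    using assms by (simp add: smooth_on_def del: Ck_on.simps)
  then have "\<forall>z\<in>S. f differentiable (at z)"
    and "\<forall>v. \<forall>z\<in>S. (\<lambda>x. frechet_derivative f (at x) v) differentiable (at z)"
    by auto
  then show ?thesis
    unfolding dzbar_differentiable_on_def dzbar_def divide_inverse
    by (auto intro!: differentiable_add differentiable_mult)
qed

lemma open_vec_left_vimage: "open S \<Longrightarrow> open (vec_left -` S)"
  and open_vec_right_vimage: "open T \<Longrightarrow> open (vec_right -` T)"
  by (simp_all add: open_vimage linear_continuous_on linear_linear linear_vec_left linear_vec_right)

lemma dz_dzbar_comp_vec_left: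
  assumes "open S" "vec_left u \<in> S" "dzbar_differentiable_on S f"
  shows "dz (Inl k) (dzbar (Inl l) (\<lambda>w. f (vec_left w))) u = dz k (dzbar l f) (vec_left u)"
    and "dz (Inr k') (dzbar t (\<lambda>w. f (vec_left w))) u = 0"
    and "dz s (dzbar (Inr l') (\<lambda>w. f (vec_left w))) u = 0"
proof -
  have diff: "f differentiable (at z)" "dzbar l f differentiable (at z)" if "z \<in> S" for z l
    using assms(3) that by (auto simp: dzbar_differentiable_on_def)
  have Inl: "dz s (dzbar (Inl l) (\<lambda>w. f (vec_left w))) u = dz s (\<lambda>w. dzbar l f (vec_left w)) u" for l s
    by (rule dz_cong_open [OF open_vec_left_vimage [OF assms(1)]])
      (use assms(2) diff in \<open>auto simp: dz_comp_vec_left\<close>)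
  have Inr: "dz s (dzbar (Inr l) (\<lambda>w. f (vec_left w))) u = dz s (\<lambda>w. 0) u" for l s
    by (rule dz_cong_open [OF open_vec_left_vimage [OF assms(1)]])
      (use assms(2) diff in \<open>auto simp: dz_comp_vec_left\<close>)
  show "dz (Inl k) (dzbar (Inl l) (\<lambda>w. f (vec_left w))) u = dz k (dzbar l f) (vec_left u)"
    and "dz s (dzbar (Inr l') (\<lambda>w. f (vec_left w))) u = 0"
    using diff assms(2) by (simp_all add: Inl Inr dz_comp_vec_left)
  show "dz (Inr k') (dzbar t (\<lambda>w. f (vec_left w))) u = 0"
    using diff assms(2) by (cases t) (simp_all add: Inl Inr dz_comp_vec_left)
qed

lemma dz_dzbar_comp_vec_right:
  assumes "open T" "vec_right u \<in> T" "dzbar_differentiable_on T f"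
  shows "dz (Inr k) (dzbar (Inr l) (\<lambda>w. f (vec_right w))) u = dz k (dzbar l f) (vec_right u)"
    and "dz (Inl k') (dzbar t (\<lambda>w. f (vec_right w))) u = 0"
    and "dz s (dzbar (Inl l') (\<lambda>w. f (vec_right w))) u = 0"
proof -
  have diff: "f differentiable (at z)" "dzbar l f differentiable (at z)" if "z \<in> T" for z l
    using assms(3) that by (auto simp: dzbar_differentiable_on_def)
  have Inr: "dz s (dzbar (Inr l) (\<lambda>w. f (vec_right w))) u = dz s (\<lambda>w. dzbar l f (vec_right w)) u" for l s
    by (rule dz_cong_open [OF open_vec_right_vimage [OF assms(1)]])
      (use assms(2) diff in \<open>auto simp: dz_comp_vec_right\<close>)
  have Inl: "dz s (dzbar (Inl l) (\<lambda>w. f (vec_right w))) u = dz s (\<lambda>w. 0) u" for l s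
    by (rule dz_cong_open [OF open_vec_right_vimage [OF assms(1)]])
      (use assms(2) diff in \<open>auto simp: dz_comp_vec_right\<close>)
  show "dz (Inr k) (dzbar (Inr l) (\<lambda>w. f (vec_right w))) u = dz k (dzbar l f) (vec_right u)"
    and "dz s (dzbar (Inl l') (\<lambda>w. f (vec_right w))) u = 0"
    using diff assms(2) by (simp_all add: Inl Inr dz_comp_vec_right)
  show "dz (Inl k') (dzbar t (\<lambda>w. f (vec_right w))) u = 0"
    using diff assms(2) by (cases t) (simp_all add: Inl Inr dz_comp_vec_right)
qed


section \<open>Block diagonal matrices and Hermitian forms\<close>

definition block_diag ::
  "complex^'m^'m \<Rightarrow> complex^'n^'n \<Rightarrow> complex^('m::finite + 'n::finite)^('m + 'n)" where
  "block_diag A B = (\<chi> s t. case (s, t) of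
     (Inl a, Inl b) \<Rightarrow> A $ a $ b | (Inr a, Inr b) \<Rightarrow> B $ a $ b | _ \<Rightarrow> 0)"

lemma block_diag_nth [simp]:
  "block_diag A B $ Inl a $ Inl b = A $ a $ b"
  "block_diag A B $ Inr c $ Inr d = B $ c $ d"
  "block_diag A B $ Inl a $ Inr d = 0"
  "block_diag A B $ Inr c $ Inl b = 0"
  by (simp_all add: block_diag_def)

lemma product_metric_eq_block_diag:
  "product_metric g h (i, j) = (\<lambda>u. block_diag (g i (vec_left u)) (h j (vec_right u)))"
  by (simp add: product_metric_def block_diag_def)

lemma matrix_inv_eqI:
  fixes A :: "complex^'m^'m"
  assumes "A ** A' = mat 1" "A' ** A = mat 1"
  shows "matrix_inv A = A'"
proof -
  have "A ** matrix_inv A = mat 1 \<and> matrix_inv A ** A = mat 1"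
    unfolding matrix_inv_def by (rule someI [of _ A']) (use assms in simp)
  then show ?thesis
    using assms(2) by (metis matrix_mul_assoc matrix_mul_lid matrix_mul_rid)
qed

lemma matrix_inv_block_diag:
  fixes A :: "complex^'m^'m::finite" and B :: "complex^'n^'n::finite"
  assumes "invertible A" "invertible B"
  shows "matrix_inv (block_diag A B) = block_diag (matrix_inv A) (matrix_inv B)"
proof -
  have mult: "block_diag C D ** block_diag C' D' = block_diag (C ** C') (D ** D')"
    for C C' :: "complex^'m^'m" and D D' :: "complex^'n^'n"
  proof -
    have "(block_diag C D ** block_diag C' D') $ s $ t = block_diag (C ** C') (D ** D') $ s $ t" for s t
      by (cases s; cases t) (simp_all add: matrix_matrix_mult_def sum_UNIV_Plus)
    then show ?thesis by (simp add: vec_eq_iff)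
  qed
  have one: "block_diag (mat 1) (mat 1) = (mat 1 :: complex^('m + 'n)^('m + 'n))"
  proof -
    have "block_diag (mat 1) (mat 1) $ s $ t = (mat 1 :: complex^('m + 'n)^('m + 'n)) $ s $ t" for s t
      by (cases s; cases t) (simp_all add: mat_def)
    then show ?thesis by (simp add: vec_eq_iff)
  qed
  have inv: "C ** matrix_inv C = mat 1 \<and> matrix_inv C ** C = mat 1"
    if "invertible C" for C :: "complex^'k^'k::finite"
    using that unfolding invertible_def matrix_inv_def by (rule someI_ex)
  show ?thesis
    by (rule matrix_inv_eqI) (simp_all add: mult one inv assms)
qed

definition hermitian_form :: "complex^'m^'m \<Rightarrow> complex^'m::finite \<Rightarrow> complex" where
  "hermitian_form A \<xi> = (\<Sum>a\<in>UNIV. \<Sum>b\<in>UNIV. A $ a $ b * \<xi> $ a * cnj (\<xi> $ b))"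

lemma hermitian_form_block_diag:
  "hermitian_form (block_diag A B) \<xi> = hermitian_form A (vec_left \<xi>) + hermitian_form B (vec_right \<xi>)"
  by (simp add: hermitian_form_def sum_UNIV_Plus vec_left_def vec_right_def)

lemma hermitian_form_0 [simp]: "hermitian_form A 0 = 0"
  by (simp add: hermitian_form_def)

lemma hermitian_form_scale:
  "hermitian_form A (of_real r *s \<xi>) = of_real (r\<^sup>2) * hermitian_form A \<xi>"
  by (simp add: hermitian_form_def sum_distrib_left power2_eq_square algebra_simps)

lemma hermitian_form_real:
  assumes "\<And>a b. A $ b $ a = cnj (A $ a $ b)"
  shows "hermitian_form A \<xi> = of_real (Re (hermitian_form A \<xi>))"
proof -
  have "cnj (hermitian_form A \<xi>) = (\<Sum>a\<in>UNIV. \<Sum>b\<in>UNIV. A $ b $ a * \<xi> $ b * cnj (\<xi> $ a))"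
    by (simp add: hermitian_form_def assms [symmetric] mult_ac)
  also have "\<dots> = hermitian_form A \<xi>"
    unfolding hermitian_form_def by (rule sum.swap)
  finally show ?thesis
    by (metis Reals_cnj_iff of_real_Re)
qed

text \<open>A vector \<open>x\<close> in the kernel makes the form vanish at the conjugate of \<open>x\<close>, so it is zero.\<close>

lemma invertible_if_definite:
  fixes A :: "complex^'m^'m::finite"
  assumes "\<And>\<xi>. \<xi> \<noteq> 0 \<Longrightarrow> hermitian_form A \<xi> \<noteq> 0"
  shows "invertible A"
proof -
  have "x = 0" if "A *v x = 0" for x
  proof (rule ccontr)
    assume "x \<noteq> 0"
    \<comment> \<open>The form is conjugate linear in its second argument, so the kernel vector enters conjugated.\<close>
    define \<xi> where "\<xi> = (\<chi> a. cnj (x $ a))"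
    have "\<xi> \<noteq> 0"
      using \<open>x \<noteq> 0\<close> by (simp add: \<xi>_def vec_eq_iff)
    moreover have "hermitian_form A \<xi> = (\<Sum>a\<in>UNIV. cnj (x $ a) * (A *v x) $ a)"
      by (simp add: hermitian_form_def \<xi>_def matrix_vector_mult_def sum_distrib_left mult_ac)
    ultimately show False
      using assms that by simp
  qed
  then have "\<exists>B. B ** A = mat 1"
    by (simp add: matrix_left_invertible_ker)
  then show ?thesis
    by (simp add: invertible_left_inverse)
qed


section \<open>The curvature of a block diagonal metric\<close>

definition curvature_form :: "(complex^'m \<Rightarrow> complex^'m^'m) \<Rightarrow> complex^'m \<Rightarrow> complex^'m::finite \<Rightarrow> complex" where
  "curvature_form G z \<xi> = (\<Sum>a\<in>UNIV. \<Sum>b\<in>UNIV. \<Sum>c\<in>UNIV. \<Sum>d\<in>UNIV.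
     chern_curvature G z a b c d * \<xi> $ a * cnj (\<xi> $ b) * \<xi> $ c * cnj (\<xi> $ d))"

lemma curvature_form_0 [simp]: "curvature_form G z 0 = 0"
  by (simp add: curvature_form_def)

lemma curvature_form_scale:
  "curvature_form G z (of_real r *s \<xi>) = of_real (r ^ 4) * curvature_form G z \<xi>"
  by (simp add: curvature_form_def sum_distrib_left power4_eq_xxxx mult_ac)

text \<open>A component of the curvature mixes the two groups of coordinates in one of two ways. If the first
  two indices differ in kind, the metric entry vanishes identically, and so does each term of the
  quadratic expression, since the inverse matrix is block diagonal too. If those two agree, some
  derivative is taken in a direction on which no entry in question depends.\<close>

lemma curvature_form_block_diag:
  fixes G :: "complex^'m \<Rightarrow> complex^'m^'m::finite" and H :: "complex^'n \<Rightarrow> complex^'n^'n::finite"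
  assumes "open S" "vec_left u \<in> S" and G: "\<And>a b. dzbar_differentiable_on S (\<lambda>z. G z $ a $ b)"
    and "open T" "vec_right u \<in> T" and H: "\<And>a b. dzbar_differentiable_on T (\<lambda>z. H z $ a $ b)"
    and inv: "invertible (G (vec_left u))" "invertible (H (vec_right u))"
  shows "curvature_form (\<lambda>u. block_diag (G (vec_left u)) (H (vec_right u))) u \<xi> =
           curvature_form G (vec_left u) (vec_left \<xi>) + curvature_form H (vec_right u) (vec_right \<xi>)"
proof -
  let ?B = "\<lambda>u. block_diag (G (vec_left u)) (H (vec_right u))"
  have "(\<lambda>z. G z $ a $ b) differentiable (at (vec_left u))" for a b
    using G assms(2) by (auto simp: dzbar_differentiable_on_def)
  note first_G = dz_comp_vec_left [OF this]
  have "(\<lambda>z. H z $ a $ b) differentiable (at (vec_right u))" for a b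
    using H assms(5) by (auto simp: dzbar_differentiable_on_def)
  note first_H = dz_comp_vec_right [OF this]
  note second = dz_dzbar_comp_vec_left [OF assms(1,2) G] dz_dzbar_comp_vec_right [OF assms(4,5) H]
  note simps = chern_curvature_def matrix_inv_block_diag [OF inv] sum_UNIV_Plus first_G first_H second
  have left: "chern_curvature ?B u (Inl a) (Inl b) (Inl c) (Inl d) = chern_curvature G (vec_left u) a b c d"
    for a b c d by (simp add: simps)
  have right: "chern_curvature ?B u (Inr a) (Inr b) (Inr c) (Inr d) = chern_curvature H (vec_right u) a b c d"
    for a b c d by (simp add: simps)
  have mixed_metric:
    "chern_curvature ?B u (Inl a) (Inr b') s t = 0" "chern_curvature ?B u (Inr a') (Inl b) s t = 0"
    for a b a' b' s t by (simp_all add: simps)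
  have mixed_derivative:
    "chern_curvature ?B u (Inl a) (Inl b) (Inr k) t = 0" "chern_curvature ?B u (Inl a) (Inl b) s (Inr k) = 0"
    "chern_curvature ?B u (Inr a') (Inr b') (Inl l) t = 0" "chern_curvature ?B u (Inr a') (Inr b') s (Inl l) = 0"
    for a b a' b' k l s t by (simp_all add: simps)
  show ?thesis
    by (simp add: curvature_form_def sum_UNIV_Plus left right mixed_metric mixed_derivative)
qed


section \<open>Holomorphic sectional curvature of a product\<close>

abbreviation sq_norm :: "('i, 'a, 'm::finite) atlas \<Rightarrow> ('i, 'm) metric \<Rightarrow> 'i \<times> 'a \<times> (complex^'m) \<Rightarrow> real" where
  "sq_norm M g \<equiv> \<lambda>(i, x, \<xi>). Re (hermitian_form (g i (coord M i x)) \<xi>)"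

lemma hol_sect_curv_eq:
  fixes g :: "('i, 'm::finite) metric"
  assumes "hermitian_form (g i (coord M i x)) \<xi> = of_real r"
  shows "hol_sect_curv M g (i, x, \<xi>) = 2 * Re (curvature_form (g i) (coord M i x) \<xi>) / r\<^sup>2"
proof -
  let ?A = "g i (coord M i x)"
  have "(\<Sum>a\<in>UNIV. \<Sum>b\<in>UNIV. \<Sum>c\<in>UNIV. \<Sum>d\<in>UNIV. ?A $ a $ b * ?A $ c $ d * \<xi> $ a * cnj (\<xi> $ b) * \<xi> $ c * cnj (\<xi> $ d))
      = (\<Sum>a\<in>UNIV. \<Sum>b\<in>UNIV. ?A $ a $ b * \<xi> $ a * cnj (\<xi> $ b) * hermitian_form ?A \<xi>)"
    by (simp add: hermitian_form_def sum_distrib_left mult_ac)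
  also have "\<dots> = hermitian_form ?A \<xi> * hermitian_form ?A \<xi>"
    by (simp add: hermitian_form_def [of ?A] sum_distrib_right)
  also have "\<dots> = of_real (r\<^sup>2)"
    by (simp add: assms power2_eq_square)
  finally have "hol_sect_curv M g (i, x, \<xi>) = Re (2 * curvature_form (g i) (coord M i x) \<xi> / of_real (r\<^sup>2))"
    by (simp add: hol_sect_curv_def Let_def curvature_form_def)
  also have "\<dots> = 2 * Re (curvature_form (g i) (coord M i x) \<xi>) / r\<^sup>2"
    by (simp only: Re_divide_of_real) simp
  finally show ?thesis .
qed

lemma hermitian_metric_form:
  assumes "hermitian_metric M g" "i \<in> charts M" "x \<in> chart_dom M i"
  shows "hermitian_form (g i (coord M i x)) \<xi> = of_real (sq_norm M g (i, x, \<xi>))"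
    and "\<xi> \<noteq> 0 \<Longrightarrow> 0 < sq_norm M g (i, x, \<xi>)"
proof -
  have z: "coord M i x \<in> chart_img M i"
    using assms(3) by (simp add: chart_img_def)
  then show "hermitian_form (g i (coord M i x)) \<xi> = of_real (sq_norm M g (i, x, \<xi>))"
    using assms unfolding hermitian_metric_def prod.case by (intro hermitian_form_real) blast
  show "0 < sq_norm M g (i, x, \<xi>)" if "\<xi> \<noteq> 0"
    using assms z that unfolding hermitian_metric_def prod.case hermitian_form_def by blast
qed

lemma hol_sect_curv_mult_sq_norm:
  assumes "hermitian_metric M g" "i \<in> charts M" "x \<in> chart_dom M i"
  shows "hol_sect_curv M g (i, x, \<xi>) * (sq_norm M g (i, x, \<xi>))\<^sup>2 = 2 * Re (curvature_form (g i) (coord M i x) \<xi>)"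
proof (cases "\<xi> = 0")
  case False
  then show ?thesis
    using hol_sect_curv_eq [where M=M and g=g, OF hermitian_metric_form(1) [OF assms]] hermitian_metric_form(2) [OF assms, of \<xi>]
    by simp
qed simp

text \<open>Under multiplication by \<open>r > 0\<close> the squared norm scales by \<open>r\<^sup>2\<close> and the curvature form by \<open>r\<^sup>4\<close>,
  which cancels in the curvature. This makes the ratio of the squared norms of the two components of a
  tangent vector of the product a free parameter.\<close>

lemma ex_rescaled_tangent_vector:
  assumes g: "hermitian_metric M g" and v: "(i, x, \<xi>) \<in> nonzero_tangent_vectors M" and "0 < t"
  obtains \<xi>' where "(i, x, \<xi>') \<in> nonzero_tangent_vectors M" "sq_norm M g (i, x, \<xi>') = t"
    "hol_sect_curv M g (i, x, \<xi>') = hol_sect_curv M g (i, x, \<xi>)"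
proof
  have i: "i \<in> charts M" "x \<in> chart_dom M i" and "\<xi> \<noteq> 0"
    using v by (auto simp: nonzero_tangent_vectors_def)
  define A where "A = sq_norm M g (i, x, \<xi>)"
  have "0 < A"
    using hermitian_metric_form(2) [OF g i \<open>\<xi> \<noteq> 0\<close>] by (simp add: A_def)
  define r where "r = sqrt (t / A)"
  let ?\<xi> = "of_real r *s \<xi>"
  have r: "0 < r" "r\<^sup>2 = t / A"
    using \<open>0 < A\<close> \<open>0 < t\<close> by (simp_all add: r_def)
  show "(i, x, ?\<xi>) \<in> nonzero_tangent_vectors M"
    using i \<open>\<xi> \<noteq> 0\<close> r(1) by (simp add: nonzero_tangent_vectors_def)
  have form: "hermitian_form (g i (coord M i x)) ?\<xi> = of_real (r\<^sup>2 * A)"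
    using hermitian_metric_form(1) [OF g i, of \<xi>]
    by (simp add: hermitian_form_scale A_def)
  then show "sq_norm M g (i, x, ?\<xi>) = t"
    using r \<open>0 < A\<close> by (simp del: of_real_mult of_real_power)
  show "hol_sect_curv M g (i, x, ?\<xi>) = hol_sect_curv M g (i, x, \<xi>)"
  proof -
    have "hol_sect_curv M g (i, x, ?\<xi>) = 2 * (r ^ 4 * Re (curvature_form (g i) (coord M i x) \<xi>)) / (r\<^sup>2 * A)\<^sup>2"
      by (simp only: hol_sect_curv_eq [where M=M and g=g, OF form] curvature_form_scale Re_complex_of_real
          times_complex.sel Im_complex_of_real) simp
    also have "(r\<^sup>2 * A)\<^sup>2 = r ^ 4 * A\<^sup>2"
      by (simp add: power_mult_distrib)
    also have "2 * (r ^ 4 * Re (curvature_form (g i) (coord M i x) \<xi>)) / (r ^ 4 * A\<^sup>2)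
        = 2 * Re (curvature_form (g i) (coord M i x) \<xi>) / A\<^sup>2"
      using r(1) by simp
    also have "\<dots> = hol_sect_curv M g (i, x, \<xi>)"
      using hol_sect_curv_eq [where M=M and g=g, OF hermitian_metric_form(1) [OF g i]] by (simp add: A_def)
    finally show ?thesis .
  qed
qed

lemma chart_regularity:
  assumes "complex_manifold M" "hermitian_metric M g" "i \<in> charts M" "x \<in> chart_dom M i"
  shows "open (chart_img M i)" "coord M i x \<in> chart_img M i"
    "dzbar_differentiable_on (chart_img M i) (\<lambda>z. g i z $ a $ b)"
    "invertible (g i (coord M i x))"
proof -
  show "open (chart_img M i)"
    using assms(1,3) by (simp add: complex_manifold_def)
  show "coord M i x \<in> chart_img M i"
    using assms(4) by (simp add: chart_img_def)
  show "dzbar_differentiable_on (chart_img M i) (\<lambda>z. g i z $ a $ b)"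
    using assms(2,3) by (intro smooth_on_imp_dzbar_differentiable_on) (simp add: hermitian_metric_def)
  show "invertible (g i (coord M i x))"
    using hermitian_metric_form(2) [OF assms(2-4)] by (intro invertible_if_definite) force
qed

text \<open>The curvature form and the squared norm on a product are the sums of those on the factors; in the
  curvature the latter is squared once more. A zero component is allowed: its summand vanishes.\<close>

lemma hol_sect_curv_product:
  fixes M :: "('i, 'a, 'm::finite) atlas" and N :: "('j, 'b, 'n::finite) atlas"
  assumes M: "complex_manifold M" "hermitian_metric M g" "i \<in> charts M" "x \<in> chart_dom M i"
    and N: "complex_manifold N" "hermitian_metric N h" "j \<in> charts N" "y \<in> chart_dom N j"
  shows "hol_sect_curv (product_manifold M N) (product_metric g h) ((i, j), (x, y), \<xi>) =
    (hol_sect_curv M g (i, x, vec_left \<xi>) * (sq_norm M g (i, x, vec_left \<xi>))\<^sup>2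
       + hol_sect_curv N h (j, y, vec_right \<xi>) * (sq_norm N h (j, y, vec_right \<xi>))\<^sup>2)
    / (sq_norm M g (i, x, vec_left \<xi>) + sq_norm N h (j, y, vec_right \<xi>))\<^sup>2"
proof -
  let ?z = "vec_pair (coord M i x) (coord N j y)"
  have z: "coord (product_manifold M N) (i, j) (x, y) = ?z"
    by (simp add: product_manifold_def)
  have form: "hermitian_form (product_metric g h (i, j) (coord (product_manifold M N) (i, j) (x, y))) \<xi>
      = of_real (sq_norm M g (i, x, vec_left \<xi>) + sq_norm N h (j, y, vec_right \<xi>))"
    using hermitian_metric_form(1) [OF M(2-4)] hermitian_metric_form(1) [OF N(2-4)]
    by (simp add: z product_metric_eq_block_diag hermitian_form_block_diag)
  have "curvature_form (product_metric g h (i, j)) ?z \<xi>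
      = curvature_form (g i) (coord M i x) (vec_left \<xi>) + curvature_form (h j) (coord N j y) (vec_right \<xi>)"
    unfolding product_metric_eq_block_diag
    by (subst curvature_form_block_diag [where S = "chart_img M i" and T = "chart_img N j"])
      (simp_all add: chart_regularity [OF M] chart_regularity [OF N])
  then show ?thesis
    unfolding hol_sect_curv_eq [where M="product_manifold M N" and g="product_metric g h", OF form] z
      hol_sect_curv_mult_sq_norm [OF M(2-4)] hol_sect_curv_mult_sq_norm [OF N(2-4)]
    by simp
qed

lemma nonzero_tangent_vectors_product:
  "((i, j), (x, y), \<xi>) \<in> nonzero_tangent_vectors (product_manifold M N) \<longleftrightarrow>
     i \<in> charts M \<and> x \<in> chart_dom M i \<and> j \<in> charts N \<and> y \<in> chart_dom N j
       \<and> (vec_left \<xi> \<noteq> 0 \<or> vec_right \<xi> \<noteq> 0)"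
  by (auto simp: nonzero_tangent_vectors_def product_manifold_def vec_eq_0_iff_left_right [of \<xi>])


section \<open>Pinching constants\<close>

text \<open>The lower bound is the Cauchy--Schwarz inequality for the vectors \<open>(1/\<surd>p, 1/\<surd>q)\<close> and
  \<open>(\<surd>p A, \<surd>q B)\<close>, with equality for \<open>p A = q B\<close>.\<close>

lemma harmonic_weight_le_weighted_squares:
  fixes p q A B :: real
  assumes "0 < p" "0 < q"
  shows "p * q / (p + q) * (A + B)\<^sup>2 \<le> p * A\<^sup>2 + q * B\<^sup>2"
proof -
  have "p * q * (A + B)\<^sup>2 \<le> p * q * (A + B)\<^sup>2 + (p * A - q * B)\<^sup>2"
    by simp
  also have "\<dots> = (p * A\<^sup>2 + q * B\<^sup>2) * (p + q)"
    by (simp add: power2_eq_square algebra_simps)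
  finally show "p * q / (p + q) * (A + B)\<^sup>2 \<le> p * A\<^sup>2 + q * B\<^sup>2"
    using assms by (simp add: field_simps)
qed

lemma sum_squares_le_square_sum: "0 \<le> A \<Longrightarrow> 0 \<le> B \<Longrightarrow> A\<^sup>2 + B\<^sup>2 \<le> (A + B)\<^sup>2"
  for A B :: real
  by (simp add: power2_sum)

text \<open>A positive quotient excludes the empty manifold, for which it is \<open>\<infinity> / -\<infinity> = 0\<close>. Otherwise the
  bounds confine the infimum and the supremum to \<open>[k c, k]\<close>, so their quotient is at least \<open>c\<close>, with
  equality only if both are extreme.\<close>

lemma pinched_imp_extremal:
  assumes "pinched M g c" "0 < k"
    and bounds: "\<And>v. v \<in> nonzero_tangent_vectors M \<Longrightarrow> k * c \<le> hol_sect_curv M g v \<and> hol_sect_curv M g v \<le> k"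
  shows "nonzero_tangent_vectors M \<noteq> {}"
    and "(INF v\<in>nonzero_tangent_vectors M. ereal (hol_sect_curv M g v)) = ereal (k * c)"
    and "(SUP v\<in>nonzero_tangent_vectors M. ereal (hol_sect_curv M g v)) = ereal k"
proof -
  let ?V = "nonzero_tangent_vectors M"
  let ?K = "\<lambda>v. ereal (hol_sect_curv M g v)"
  define I where "I = (INF v\<in>?V. ?K v)"
  define S where "S = (SUP v\<in>?V. ?K v)"
  have c: "0 < c" and IS: "I / S = ereal c"
    using assms(1) by (auto simp: pinched_def I_def S_def)
  show "?V \<noteq> {}"
  proof
    assume "?V = {}"
    then have "I = \<infinity>" "S = -\<infinity>"
      by (simp_all add: I_def S_def top_ereal_def bot_ereal_def)
    then show False
      using IS c by simp
  qed
  then obtain v where v: "v \<in> ?V" by blast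
  have lo: "ereal (k * c) \<le> I"
    unfolding I_def using bounds by (intro INF_greatest) simp
  have hi: "S \<le> ereal k"
    unfolding S_def using bounds by (intro SUP_least) simp
  have "I \<le> ?K v" "?K v \<le> S"
    using v by (auto simp: I_def S_def intro: INF_lower SUP_upper)
  then obtain a b where ab: "I = ereal a" "S = ereal b" "k * c \<le> a" "a \<le> b" "b \<le> k"
    using lo hi by (cases I; cases S) auto
  have "0 < b"
    using ab c assms(2) mult_pos_pos [of k c] by linarith
  then have "a = c * b"
    using IS ab by (simp add: field_simps)
  then have "c * k \<le> c * b"
    using ab(3) by (simp add: mult.commute)
  then have "b = k"
    using c ab(5) by simp
  then show "(INF v\<in>?V. ?K v) = ereal (k * c)" "(SUP v\<in>?V. ?K v) = ereal k"
    using ab \<open>a = c * b\<close> by (simp_all add: I_def S_def mult.commute)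
qed

lemma pinchedI_extremal:
  assumes "0 < c" "c \<le> 1" "0 < k"
    and bounds: "\<And>v. v \<in> nonzero_tangent_vectors M \<Longrightarrow> k * c \<le> hol_sect_curv M g v \<and> hol_sect_curv M g v \<le> k"
    and low: "\<And>e. 0 < e \<Longrightarrow> \<exists>v\<in>nonzero_tangent_vectors M. hol_sect_curv M g v < k * c + e"
    and high: "\<And>e. 0 < e \<Longrightarrow> \<exists>v\<in>nonzero_tangent_vectors M. k - e < hol_sect_curv M g v"
  shows "pinched M g c"
proof -
  let ?V = "nonzero_tangent_vectors M"
  let ?K = "\<lambda>v. ereal (hol_sect_curv M g v)"
  have "(INF v\<in>?V. ?K v) = ereal (k * c)"
  proof (rule antisym)
    show "(INF v\<in>?V. ?K v) \<le> ereal (k * c)"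
    proof (rule ereal_le_epsilon2)
      fix e :: real assume "0 < e"
      with low obtain v where "v \<in> ?V" "hol_sect_curv M g v < k * c + e" by blast
      then show "(INF v\<in>?V. ?K v) \<le> ereal (k * c) + ereal e"
        by (intro INF_lower2 [of v]) auto
    qed
  qed (use bounds in \<open>auto intro!: INF_greatest\<close>)
  moreover have "(SUP v\<in>?V. ?K v) = ereal k"
  proof (rule antisym)
    show "ereal k \<le> (SUP v\<in>?V. ?K v)"
    proof (rule ereal_le_epsilon2)
      fix e :: real assume "0 < e"
      with high obtain v where v: "v \<in> ?V" "k - e < hol_sect_curv M g v" by blast
      have "ereal k \<le> ?K v + ereal e"
        using v(2) by simp
      also have "\<dots> \<le> (SUP v\<in>?V. ?K v) + ereal e"
        using v(1) by (intro add_right_mono SUP_upper)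
      finally show "ereal k \<le> (SUP v\<in>?V. ?K v) + ereal e" .
    qed
  qed (use bounds in \<open>auto intro!: SUP_least\<close>)
  moreover have "positive_hsc M g"
    unfolding positive_hsc_def using bounds mult_pos_pos [OF assms(3,1)] by force
  ultimately show ?thesis
    using assms(1-3) by (simp add: pinched_def)
qed

theorem theorem1p2:
  fixes M :: "('i, 'a, 'm::finite) atlas" and g :: "('i, 'm) metric"
    and N :: "('j, 'b, 'n::finite) atlas" and h :: "('j, 'n) metric"
    and cM cN k :: real
  assumes "complex_manifold M" and "hermitian_metric M g"
    and "complex_manifold N" and "hermitian_metric N h"
    and "0 < cM" and "cM \<le> 1" and "0 < cN" and "cN \<le> 1"
    and "positive_hsc M g" and "pinched M g cM"
    and "positive_hsc N h" and "pinched N h cN"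
    and "0 < k"
    and "\<forall>v\<in>nonzero_tangent_vectors M. k * cM \<le> hol_sect_curv M g v \<and> hol_sect_curv M g v \<le> k"
    and "\<forall>w\<in>nonzero_tangent_vectors N. k * cN \<le> hol_sect_curv N h w \<and> hol_sect_curv N h w \<le> k"
  shows "(\<forall>u\<in>nonzero_tangent_vectors (product_manifold M N).
            k * (cM * cN / (cM + cN)) \<le> hol_sect_curv (product_manifold M N) (product_metric g h) u \<and>
            hol_sect_curv (product_manifold M N) (product_metric g h) u \<le> k) \<and>
         pinched (product_manifold M N) (product_metric g h) (cM * cN / (cM + cN))"
proof -
  let ?P = "product_manifold M N" and ?c = "cM * cN / (cM + cN)"
  let ?K = "hol_sect_curv ?P (product_metric g h)"
  note k = \<open>0 < k\<close> and cM = \<open>0 < cM\<close> and cN = \<open>0 < cN\<close>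
  note M = assms(1,2) and N = assms(3,4)
  note M_bounds = bspec [OF assms(14)] and N_bounds = bspec [OF assms(15)]
  note exM = pinched_imp_extremal [OF assms(10) k M_bounds]
  note exN = pinched_imp_extremal [OF assms(12) k N_bounds]

  have bounds: "k * ?c \<le> ?K u \<and> ?K u \<le> k" if u: "u \<in> nonzero_tangent_vectors ?P" for u
  proof -
    obtain i j x y \<xi> where u_eq: "u = ((i, j), (x, y), \<xi>)"
      by (metis prod.exhaust)
    have i: "i \<in> charts M" "x \<in> chart_dom M i" and j: "j \<in> charts N" "y \<in> chart_dom N j"
      and nz: "vec_left \<xi> \<noteq> 0 \<or> vec_right \<xi> \<noteq> 0"
      using u by (auto simp: u_eq nonzero_tangent_vectors_product)
    define A where "A = sq_norm M g (i, x, vec_left \<xi>)"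
    define B where "B = sq_norm N h (j, y, vec_right \<xi>)"
    define F where "F = hol_sect_curv M g (i, x, vec_left \<xi>) * A\<^sup>2 + hol_sect_curv N h (j, y, vec_right \<xi>) * B\<^sup>2"
    have A: "0 \<le> A" "vec_left \<xi> \<noteq> 0 \<Longrightarrow> 0 < A" "vec_left \<xi> = 0 \<Longrightarrow> A = 0"
      using hermitian_metric_form(2) [OF M(2) i, of "vec_left \<xi>"]
      by (cases "vec_left \<xi> = 0"; simp add: A_def)+
    have B: "0 \<le> B" "vec_right \<xi> \<noteq> 0 \<Longrightarrow> 0 < B" "vec_right \<xi> = 0 \<Longrightarrow> B = 0"
      using hermitian_metric_form(2) [OF N(2) j, of "vec_right \<xi>"]
      by (cases "vec_right \<xi> = 0"; simp add: B_def)+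
    have "0 < A + B"
      using nz A B by fastforce
    have K: "?K u = F / (A + B)\<^sup>2"
      unfolding u_eq F_def A_def B_def by (rule hol_sect_curv_product [OF M i N j])
    have FA: "k * cM * A\<^sup>2 \<le> hol_sect_curv M g (i, x, vec_left \<xi>) * A\<^sup>2
        \<and> hol_sect_curv M g (i, x, vec_left \<xi>) * A\<^sup>2 \<le> k * A\<^sup>2"
      using M_bounds [of "(i, x, vec_left \<xi>)"] i A(3)
      by (cases "vec_left \<xi> = 0") (auto simp: nonzero_tangent_vectors_def intro!: mult_right_mono)
    have FB: "k * cN * B\<^sup>2 \<le> hol_sect_curv N h (j, y, vec_right \<xi>) * B\<^sup>2
        \<and> hol_sect_curv N h (j, y, vec_right \<xi>) * B\<^sup>2 \<le> k * B\<^sup>2"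
      using N_bounds [of "(j, y, vec_right \<xi>)"] j B(3)
      by (cases "vec_right \<xi> = 0") (auto simp: nonzero_tangent_vectors_def intro!: mult_right_mono)
    have "k * ?c * (A + B)\<^sup>2 \<le> k * (cM * A\<^sup>2 + cN * B\<^sup>2)"
      using mult_left_mono [OF harmonic_weight_le_weighted_squares [OF cM cN, of A B], of k] k
      by (simp add: mult_ac)
    also have "\<dots> \<le> F"
      using FA FB by (simp add: F_def algebra_simps)
    finally have "k * ?c * (A + B)\<^sup>2 \<le> F" .
    moreover have "F \<le> k * (A\<^sup>2 + B\<^sup>2)"
      using FA FB by (simp add: F_def algebra_simps)
    then have "F \<le> k * (A + B)\<^sup>2"
      using mult_left_mono [OF sum_squares_le_square_sum [OF A(1) B(1)], of k] k by linarith
    ultimately show ?thesis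
      unfolding K using \<open>0 < A + B\<close> by (simp only: pos_le_divide_eq pos_divide_le_eq zero_less_power)
  qed

  have "0 < ?c"
    using cM cN by simp
  have "cM * cN \<le> cM * 1"
    using cM \<open>cN \<le> 1\<close> by (intro mult_left_mono) auto
  then have "cM * cN \<le> cM + cN"
    using cN by linarith
  then have "?c \<le> 1"
    using cM cN by (simp add: divide_le_eq_1)

  have low: "\<exists>u\<in>nonzero_tangent_vectors ?P. ?K u < k * ?c + e" if "0 < e" for e
  proof -
    have "(INF v\<in>nonzero_tangent_vectors M. ereal (hol_sect_curv M g v)) < ereal (k * cM + e)"
      using exM(2) that by simp
    then obtain v where v: "v \<in> nonzero_tangent_vectors M" "hol_sect_curv M g v < k * cM + e"
      by (auto simp: INF_less_iff)
    have "(INF w\<in>nonzero_tangent_vectors N. ereal (hol_sect_curv N h w)) < ereal (k * cN + e)"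
      using exN(2) that by simp
    then obtain w where w: "w \<in> nonzero_tangent_vectors N" "hol_sect_curv N h w < k * cN + e"
      by (auto simp: INF_less_iff)
    obtain i x \<alpha>\<^sub>0 j y \<beta>\<^sub>0 where vw: "v = (i, x, \<alpha>\<^sub>0)" "w = (j, y, \<beta>\<^sub>0)"
      by (metis prod.exhaust)
    \<comment> \<open>The squared norms are those for which the lower bound is an equality.\<close>
    obtain \<alpha> where \<alpha>: "(i, x, \<alpha>) \<in> nonzero_tangent_vectors M" "sq_norm M g (i, x, \<alpha>) = cN"
      "hol_sect_curv M g (i, x, \<alpha>) = hol_sect_curv M g v"
      using ex_rescaled_tangent_vector [OF M(2) _ cN] v(1) unfolding vw by blast
    obtain \<beta> where \<beta>: "(j, y, \<beta>) \<in> nonzero_tangent_vectors N" "sq_norm N h (j, y, \<beta>) = cM"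
      "hol_sect_curv N h (j, y, \<beta>) = hol_sect_curv N h w"
      using ex_rescaled_tangent_vector [OF N(2) _ cM] w(1) unfolding vw by blast
    have i: "i \<in> charts M" "x \<in> chart_dom M i" and j: "j \<in> charts N" "y \<in> chart_dom N j"
      and "\<alpha> \<noteq> 0"
      using \<alpha>(1) \<beta>(1) by (auto simp: nonzero_tangent_vectors_def)
    let ?u = "((i, j), (x, y), vec_pair \<alpha> \<beta>)"
    have "?u \<in> nonzero_tangent_vectors ?P"
      using i j \<open>\<alpha> \<noteq> 0\<close> by (simp add: nonzero_tangent_vectors_product)
    moreover have "?K ?u < k * ?c + e"
    proof -
      have "?K ?u = (hol_sect_curv M g v * cN\<^sup>2 + hol_sect_curv N h w * cM\<^sup>2) / (cN + cM)\<^sup>2"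
        using \<alpha>(2,3) \<beta>(2,3) by (simp add: hol_sect_curv_product [OF M i N j])
      also have "\<dots> < ((k * cM + e) * cN\<^sup>2 + (k * cN + e) * cM\<^sup>2) / (cN + cM)\<^sup>2"
        using v(2) w(2) cM cN by (intro divide_strict_right_mono add_strict_mono mult_strict_right_mono) auto
      also have "\<dots> = k * ?c + e * ((cN\<^sup>2 + cM\<^sup>2) / (cN + cM)\<^sup>2)"
      proof -
        have "(k * cM + e) * cN\<^sup>2 + (k * cN + e) * cM\<^sup>2 = k * (cM * cN) * (cN + cM) + e * (cN\<^sup>2 + cM\<^sup>2)"
          by (simp add: power2_eq_square algebra_simps)
        moreover have "k * (cM * cN) * (cN + cM) / (cN + cM)\<^sup>2 = k * ?c"
          using cM cN by (simp add: power2_eq_square add.commute)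
        ultimately show ?thesis
          by (metis add_divide_distrib times_divide_eq_right)
      qed
      also have "\<dots> \<le> k * ?c + e * 1"
        using that cM cN sum_squares_le_square_sum [of cN cM]
        by (intro add_left_mono mult_left_mono) (auto simp: divide_le_eq_1)
      finally show ?thesis by simp
    qed
    ultimately show ?thesis by blast
  qed

  have high: "\<exists>u\<in>nonzero_tangent_vectors ?P. k - e < ?K u" if "0 < e" for e
  proof -
    have "ereal (k - e) < (SUP v\<in>nonzero_tangent_vectors M. ereal (hol_sect_curv M g v))"
      using exM(3) that by simp
    then obtain v where v: "v \<in> nonzero_tangent_vectors M" "k - e < hol_sect_curv M g v"
      by (auto simp: less_SUP_iff)
    obtain w where w: "w \<in> nonzero_tangent_vectors N"
      using exN(1) by blast
    obtain i x \<alpha> j y \<beta> where vw: "v = (i, x, \<alpha>)" "w = (j, y, \<beta>)"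
      by (metis prod.exhaust)
    have i: "i \<in> charts M" "x \<in> chart_dom M i" and j: "j \<in> charts N" "y \<in> chart_dom N j"
      and "\<alpha> \<noteq> 0"
      using v(1) w by (auto simp: vw nonzero_tangent_vectors_def)
    let ?u = "((i, j), (x, y), vec_pair \<alpha> 0)"
    have "?u \<in> nonzero_tangent_vectors ?P"
      using i j \<open>\<alpha> \<noteq> 0\<close> by (simp add: nonzero_tangent_vectors_product)
    moreover have "?K ?u = hol_sect_curv M g v"
      using hermitian_metric_form(2) [OF M(2) i \<open>\<alpha> \<noteq> 0\<close>]
      by (simp add: hol_sect_curv_product [OF M i N j] vw)
    ultimately show ?thesis
      using v(2) by metis
  qed

  show ?thesis
    using bounds pinchedI_extremal [OF \<open>0 < ?c\<close> \<open>?c \<le> 1\<close> k bounds low high] by auto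
qed

end
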